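(* Let $R$ be a PID and let $I$ be a nonzero ideal of $R$. Then every matrix in $M_2(R/I)$ is an $I$-matrix.
   Context: Let $k:=\gcd(I)$ be a (fixed, arbitrary) greatest common divisor in $R$ of all elements of $I$; $k\neq 0$. For $r\in R$, $\hat r$ denotes its image in $R/I$. A matrix $\begin{bmatrix}\hat e&\hat f\\ \hat g&\hat h\end{bmatrix}\in M_2(R/I)$ is called an $I$-matrix if there is $t\in R$ with $t\mid k$ such that at least one of the following equalities of ideals of $R/I$ holds: $\langle\hat e-\hat h,\hat f\rangle=\langle\hat t\rangle$, or $\langle\hat e-\hat h,\hat g\rangle=\langle\hat t\rangle$, or $\langle\hat f,\hat g\rangle=\langle\hat t\rangle$. *)

theory Defs
  imports "HOL-Algebra.Algebra" "HOL-Analysis.Finite_Cartesian_Product"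
begin

definition mat2_carrier :: "('a, 'm) ring_scheme \<Rightarrow> ('a ^ 2 ^ 2) set" where
  "mat2_carrier S = {A. \<forall>i j. A $ i $ j \<in> carrier S}"

text \<open>The divisibility relation is that of the multiplicative monoid of the whole ring,
  so the zero element is included (and is divisible by every element).\<close>

definition is_gcd_of_set :: "('a, 'm) ring_scheme \<Rightarrow> 'a \<Rightarrow> 'a set \<Rightarrow> bool" where
  "is_gcd_of_set R k A \<longleftrightarrow>
     k \<in> carrier R \<and>
     (\<forall>a\<in>A. k divides\<^bsub>R\<^esub> a) \<and>
     (\<forall>d\<in>carrier R. (\<forall>a\<in>A. d divides\<^bsub>R\<^esub> a) \<longrightarrow> d divides\<^bsub>R\<^esub> k)"

text \<open>The parameter \<open>k\<close> is meant to be a greatest common divisor of the elements of \<open>I\<close>.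
  The image of \<open>t\<close> in the quotient ring is the coset \<open>I +>\<^bsub>R\<^esub> t\<close>.\<close>

definition I_matrix ::
  "('a, 'm) ring_scheme \<Rightarrow> 'a set \<Rightarrow> 'a \<Rightarrow> 'a set ^ 2 ^ 2 \<Rightarrow> bool" where
  "I_matrix R I k A \<longleftrightarrow>
     A \<in> mat2_carrier (R Quot I) \<and>
     (let Q = R Quot I; e = A $ 1 $ 1; f = A $ 1 $ 2; g = A $ 2 $ 1; h = A $ 2 $ 2
      in \<exists>t\<in>carrier R. t divides\<^bsub>R\<^esub> k \<and>
           (Idl\<^bsub>Q\<^esub> {e \<ominus>\<^bsub>Q\<^esub> h, f} = Idl\<^bsub>Q\<^esub> {I +>\<^bsub>R\<^esub> t} \<or>
            Idl\<^bsub>Q\<^esub> {e \<ominus>\<^bsub>Q\<^esub> h, g} = Idl\<^bsub>Q\<^esub> {I +>\<^bsub>R\<^esub> t} \<or>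
            Idl\<^bsub>Q\<^esub> {f, g} = Idl\<^bsub>Q\<^esub> {I +>\<^bsub>R\<^esub> t}))"

end

theory Submission
  imports Defs
begin

text \<open>Every ideal of \<open>R/I\<close> is the image of an ideal of \<open>R\<close> containing \<open>I\<close>. The latter is
  principal, and its generator divides all elements of \<open>I\<close>, hence their greatest common divisor.\<close>

lemma (in principal_domain) quotient_ideal_generator:
  assumes I: "ideal I R" and k: "is_gcd_of_set R k I" and L: "ideal L (R Quot I)"
  obtains t where "t \<in> carrier R" "t divides k" "L = Idl\<^bsub>R Quot I\<^esub> {I +> t}"
proof -
  interpret I: ideal I R by fact
  interpret Q: ring "R Quot I" by (rule I.quotient_is_ring)
  interpret L: ideal L "R Quot I" by fact
  interpret h: ring_hom_ring R "R Quot I" "(+>) I" by (rule I.rcos_ring_hom_ring)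
  \<comment> \<open>The preimage of \<open>L\<close> under the projection \<open>R\<close> to
    \<open>R Quot I\<close>; a generator of \<open>J\<close> in \<open>R\<close> serves as the
    witness \<open>t\<close>.\<close>
  define J where "J = {x \<in> carrier R. I +> x \<in> L}"
  have "ideal J R"
    unfolding J_def by (rule h.ideal_vimage[OF L])
  then obtain t where t: "t \<in> carrier R" "J = PIdl t"
    using exists_gen by blast
  have tJ: "t \<in> J"
    using t cgenideal_self by simp
  have J_dvd: "t divides x" if "x \<in> J" for x
    using that t m_comm unfolding cgenideal_def factor_def by auto
  \<comment> \<open>Every element of \<open>I\<close> maps to the zero coset, which lies in
    \<open>L\<close>. Hence \<open>t\<close> is a common divisor of \<open>I\<close>, and the
    universal property of \<open>k\<close> gives \<open>t divides k\<close>.\<close>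
  have "I \<subseteq> J"
  proof
    fix x assume x: "x \<in> I"
    then have "I +> x \<in> L"
      using a_rcos_zero[OF I x] L.zero_closed by (simp only: FactRing_def ring.simps)
    with x show "x \<in> J"
      unfolding J_def using I.Icarr by blast
  qed
  then have "t divides k"
    using k t J_dvd unfolding is_gcd_of_set_def by blast
  moreover have "L = Idl\<^bsub>R Quot I\<^esub> {I +> t}"
  proof
    show "Idl\<^bsub>R Quot I\<^esub> {I +> t} \<subseteq> L"
      using tJ by (intro Q.genideal_minimal[OF L]) (simp add: J_def)
  next
    interpret T: ideal "Idl\<^bsub>R Quot I\<^esub> {I +> t}" "R Quot I"
      using t by (intro Q.genideal_ideal) simp
    show "L \<subseteq> Idl\<^bsub>R Quot I\<^esub> {I +> t}"
    proof
      fix y assume y: "y \<in> L"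
      then have "y \<in> carrier (R Quot I)"
        by (rule L.Icarr)
      \<comment> \<open>Lift \<open>y\<close> to a representative \<open>x\<close>. It lies in
        \<open>J\<close>, so it is a multiple \<open>r \<otimes> t\<close>; projecting back makes
        \<open>y\<close> a multiple of the coset of \<open>t\<close>, which the ideal generated by
        that coset absorbs.\<close>
      then obtain x where x: "x \<in> carrier R" "y = I +> x"
        unfolding FactRing_def A_RCOSETS_def' partial_object.simps by blast
      with y have "x \<in> PIdl t"
        using t unfolding J_def by auto
      then obtain r where r: "r \<in> carrier R" "x = r \<otimes> t"
        unfolding cgenideal_def by blast
      then have "y = (I +> r) \<otimes>\<^bsub>R Quot I\<^esub> (I +> t)"
        using x t by simp
      moreover have "I +> t \<in> Idl\<^bsub>R Quot I\<^esub> {I +> t}"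
        using t by (intro Q.genideal_self') simp
      ultimately show "y \<in> Idl\<^bsub>R Quot I\<^esub> {I +> t}"
        using r T.I_l_closed by simp
    qed
  qed
  ultimately show ?thesis
    using that t by blast
qed

theorem corollary3p29:
  fixes R :: "('a, 'm) ring_scheme" and I :: "'a set" and k :: 'a
    and A :: "'a set ^ 2 ^ 2"
  assumes "principal_domain R"
    and "ideal I R" and "I \<noteq> {\<zero>\<^bsub>R\<^esub>}"
    and "is_gcd_of_set R k I"
    and "A \<in> mat2_carrier (R Quot I)"
  shows "I_matrix R I k A"
proof -
  interpret principal_domain R by fact
  interpret Q: ring "R Quot I"
    by (rule ideal.quotient_is_ring) fact
  \<comment> \<open>The off-diagonal entries are chosen, so the last of the three alternatives in
    \<open>I_matrix\<close> is the one established; the ideal they generate is a legitimate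
    \<open>L\<close> for the lemma.\<close>
  have "ideal (Idl\<^bsub>R Quot I\<^esub> {A $ 1 $ 2, A $ 2 $ 1}) (R Quot I)"
    using assms(5) by (intro Q.genideal_ideal) (simp add: mat2_carrier_def)
  then obtain t where "t \<in> carrier R" "t divides\<^bsub>R\<^esub> k"
    "Idl\<^bsub>R Quot I\<^esub> {A $ 1 $ 2, A $ 2 $ 1} = Idl\<^bsub>R Quot I\<^esub> {I +>\<^bsub>R\<^esub> t}"
    using quotient_ideal_generator assms(2,4) by blast
  then show ?thesis
    using assms(5) unfolding I_matrix_def Let_def by blast
qed

end
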